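(* Let $p>3$ be a prime and $r$ a positive integer. Then $$\sum_{k=0}^{\frac{p^r-1}{2}} (4k+1) \left(\frac{(\frac12)_k}{k!}\right)^4\equiv p^r \pmod{p^{3+r}}.$$
   Context: For $a\in\mathbb{C}$ and $k\in\mathbb{N}$, $(a)_k=a(a+1)\cdots(a+k-1)$ denotes the rising factorial, with $(a)_0=1$. A congruence $A\equiv B \pmod{p^m}$ between rational numbers means that $A-B\in p^m\mathbb{Z}_{(p)}$ (i.e. $A-B$ is $p^m$ times a rational number whose denominator is prime to $p$). *)

theory Defs
  imports Complex_Main "HOL-Computational_Algebra.Primes"
begin

definition localized_ints :: "nat \<Rightarrow> rat set" where
  "localized_ints p = {x. coprime (snd (quotient_of x)) (int p)}"

definition rat_cong :: "rat \<Rightarrow> rat \<Rightarrow> nat \<Rightarrow> nat \<Rightarrow> bool" where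
  "rat_cong A B p m \<longleftrightarrow> (\<exists>x \<in> localized_ints p. A - B = of_nat (p ^ m) * x)"

end

theory Submission
  imports Defs
begin

text \<open>Write \<open>n = p\<^sup>r = 2 N + 1\<close>, \<open>A\<^sub>k = (1/2)\<^sub>k / k!\<close> and \<open>x\<^sub>i = n / (2 i)\<close>. Expanding one factor
  \<open>A\<^sub>k\<^sup>2\<close> by the Pfaff--Saalschuetz formula and exchanging the summations makes the sum over \<open>k\<close>
  telescope. The truncated sum becomes
  \<open>n A\<^sub>N\<^sup>2 \<Sum>\<^sub>j n / (2 j + 1) (-1)\<^sup>j (N choose j) A\<^sub>j \<Prod>\<^sub>i\<^sub>\<le>\<^sub>j (1 + x\<^sub>i)\<close>. If each product of the \<open>1 + x\<^sub>i\<close> is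
  replaced by the inverse of the product of the \<open>1 - x\<^sub>i\<close>, Pfaff--Saalschuetz applies again and the
  expression equals \<open>n\<close> exactly. The replacement changes the \<open>j\<close>-th term by a multiple of
  \<open>n / (2 j + 1) (\<Prod>\<^sub>i\<^sub>\<le>\<^sub>j (1 - x\<^sub>i\<^sup>2) - 1)\<close>. Every \<open>x\<^sub>i\<close> is divisible by \<open>p\<close>, and so is
  \<open>n / (2 j + 1)\<close> unless \<open>j = N\<close>; for \<open>j = N\<close> the third factor of \<open>p\<close> comes from the sum of the
  \<open>x\<^sub>i\<^sup>2\<close>, which is where \<open>p > 3\<close> enters.\<close>

section \<open>The Pfaff--Saalschuetz summation\<close>

text \<open>The terminating 3F2 summation with upper parameters a, b, -N, multiplied through by
  \<open>pochhammer c N * pochhammer (c - a - b) N\<close>. Cleared of denominators it is a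
  polynomial identity, so it makes sense in every commutative ring and yields to induction on
  N.\<close>

theorem pfaff_saalschuetz:
  fixes a b c :: "'a :: comm_ring_1"
  shows "(\<Sum>k\<le>N. of_nat (N choose k) * pochhammer a k * pochhammer b k
            * pochhammer (c - a - b) (N - k) * pochhammer (c + of_nat k) (N - k))
         = pochhammer (c - a) N * pochhammer (c - b) N"
proof (induction N)
  case 0
  show ?case by simp
next
  case (Suc N)
  define e where "e = c - a - b"
  define t where "t = (\<lambda>N k. of_nat (N choose k) * pochhammer a k * pochhammer b k
            * pochhammer e (N - k) * pochhammer (c + of_nat k) (N - k))"
  \<comment> \<open>A term for \<open>Suc N\<close> splits as
    \<open>t (Suc N) k = u k + v (k - 1)\<close>, with only \<open>u\<close> at k = 0 and only
    \<open>v\<close> at k = Suc N. Regrouped, \<open>u k + v k\<close> is a multiple of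
    \<open>t N k\<close> whose factor is independent of k.\<close>
  define u where "u = (\<lambda>k. of_nat (N choose k) * pochhammer a k * pochhammer b k
            * pochhammer e (Suc N - k) * pochhammer (c + of_nat k) (N - k) * (c + of_nat N + of_nat k))"
  define v where "v = (\<lambda>k. of_nat (N choose k) * pochhammer a (Suc k) * pochhammer b (Suc k)
            * pochhammer e (N - k) * pochhammer (c + of_nat k) (N - k))"
  have t0: "t (Suc N) 0 = u 0"
    by (simp add: t_def u_def pochhammer_Suc algebra_simps)
  have tN: "t (Suc N) (Suc N) = v N"
    by (simp add: t_def v_def)
  have tk: "t (Suc N) (Suc k) = u (Suc k) + v k" if "k < N" for k
  proof -
    obtain d where d: "N = Suc (k + d)" using \<open>k < N\<close> less_iff_Suc_add by auto
    have nat_id: "(N choose k) * (N - k) = Suc k * (N choose Suc k)"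
      using binomial_absorb_comp[of N k] binomial_absorption[of k "N"] d
      by (metis Suc_times_binomial_add binomial_symmetric diff_Suc_1 mult.commute
          add_diff_cancel_left' le_add1 add_Suc_right Suc_diff_le)
    have eq: "(of_nat (N choose k) :: 'a) * (1 + of_nat d) = (1 + of_nat k) * of_nat (N choose Suc k)"
      using arg_cong[OF nat_id, of "of_nat :: nat \<Rightarrow> 'a"] d
      by (simp del: binomial_Suc_Suc mult_Suc mult_Suc_right)
    \<comment> \<open>Pascal's rule reduces this to \<open>eq\<close>, the absorption identity with
      N - k = d + 1.\<close>
    have ch: "(of_nat (Suc N choose Suc k) :: 'a) * (c + of_nat N)
        = of_nat (N choose Suc k) * (c + of_nat N + of_nat (Suc k)) + of_nat (N choose k) * (c + of_nat k)"
      using eq by (simp add: d algebra_simps)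
    have p1: "pochhammer (c + of_nat (Suc k)) (Suc N - Suc k)
        = pochhammer (c + of_nat (Suc k)) d * (c + of_nat N)"
      by (simp add: d pochhammer_Suc algebra_simps)
    have p2: "pochhammer (c + of_nat k) (N - k) = (c + of_nat k) * pochhammer (c + of_nat (Suc k)) d"
      by (simp add: d pochhammer_rec algebra_simps)
    define X where "X = pochhammer a (Suc k) * pochhammer b (Suc k) * pochhammer e (Suc d) * pochhammer (c + of_nat (Suc k)) d"
    have "t (Suc N) (Suc k) = X * (of_nat (Suc N choose Suc k) * (c + of_nat N))"
      unfolding t_def p1 X_def using d by (simp add: mult_ac del: binomial_Suc_Suc pochhammer_Suc of_nat_Suc)
    also have "\<dots> = X * (of_nat (N choose Suc k) * (c + of_nat N + of_nat (Suc k)))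
                    + X * (of_nat (N choose k) * (c + of_nat k))"
      unfolding ch by (simp only: distrib_left)
    also have "X * (of_nat (N choose Suc k) * (c + of_nat N + of_nat (Suc k))) = u (Suc k)"
      unfolding u_def X_def using d by (simp add: mult_ac del: binomial_Suc_Suc of_nat_Suc)
    also have "X * (of_nat (N choose k) * (c + of_nat k)) = v k"
      unfolding v_def p2 X_def using d by (simp add: mult_ac del: binomial_Suc_Suc of_nat_Suc)
    finally show ?thesis .
  qed
  have uv: "u k + v k = (c - a + of_nat N) * (c - b + of_nat N) * t N k" if "k \<le> N" for k
  proof -
    obtain d where d: "N = k + d" using \<open>k \<le> N\<close> le_iff_add by auto
    have "u k + v k = t N k * ((e + of_nat d) * (c + of_nat N + of_nat k)
            + (a + of_nat k) * (b + of_nat k))"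
      unfolding u_def v_def t_def using d
      by (simp add: Suc_diff_le pochhammer_Suc algebra_simps)
    also have "(e + of_nat d) * (c + of_nat N + of_nat k) + (a + of_nat k) * (b + of_nat k)
        = (c - a + of_nat N) * (c - b + of_nat N)"
      unfolding e_def d by (simp add: algebra_simps)
    finally show ?thesis by (simp add: mult_ac)
  qed
  have "(\<Sum>k\<le>Suc N. t (Suc N) k) = t (Suc N) 0 + (\<Sum>k<N. t (Suc N) (Suc k)) + t (Suc N) (Suc N)"
    by (subst sum.atMost_shift) (simp add: add_ac)
  also have "\<dots> = (u 0 + (\<Sum>k<N. u (Suc k))) + ((\<Sum>k<N. v k) + v N)"
    by (simp add: t0 tN tk sum.distrib)
  also have "\<dots> = (\<Sum>k\<le>N. u k) + (\<Sum>k\<le>N. v k)"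
    by (simp only: sum.atMost_shift[of u N] sum.lessThan_Suc[of v N] flip: lessThan_Suc_atMost[of N])
       (simp add: lessThan_Suc_atMost sum.atMost_shift[of u N])
  also have "\<dots> = (\<Sum>k\<le>N. (c - a + of_nat N) * (c - b + of_nat N) * t N k)"
    by (simp add: uv flip: sum.distrib)
  also have "\<dots> = (c - a + of_nat N) * (c - b + of_nat N) * (\<Sum>k\<le>N. t N k)"
    by (simp add: sum_distrib_left)
  also have "(\<Sum>k\<le>N. t N k) = pochhammer (c - a) N * pochhammer (c - b) N"
    using Suc.IH by (simp add: t_def e_def)
  finally show ?case
    by (simp add: t_def e_def pochhammer_Suc mult_ac)
qed

section \<open>A Whipple-type transformation of the truncated sum\<close>

text \<open>This is the central binomial coefficient (2k choose k) divided by 4^k.\<close>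

definition half_ratio :: "nat \<Rightarrow> 'a :: field_char_0" where
  "half_ratio k = pochhammer (1 / 2) k / fact k"

lemma half_ratio_0 [simp]: "half_ratio 0 = 1"
  by (simp add: half_ratio_def)

lemma half_ratio_Suc:
  "2 * (of_nat k + 1) * (half_ratio (Suc k) :: 'a :: field_char_0) = (2 * of_nat k + 1) * half_ratio k"
proof -
  have nz: "(of_nat k + 1 :: 'a) \<noteq> 0" using of_nat_neq_0[of k] by (simp add: add.commute)
  have "half_ratio (Suc k) = half_ratio k * ((1 / 2 + of_nat k) / (of_nat k + 1) :: 'a)"
    by (simp add: half_ratio_def pochhammer_Suc mult_ac add_ac)
  then have "(of_nat k + 1) * half_ratio (Suc k) = half_ratio k * (1 / 2 + of_nat k :: 'a)"
    using nz by simp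
  then have "2 * ((of_nat k + 1) * half_ratio (Suc k)) = 2 * (half_ratio k * (1 / 2 + of_nat k :: 'a))"
    by simp
  then show ?thesis by (simp add: algebra_simps)
qed

text \<open>Pfaff-Saalschuetz with a = k + 1/2, b = 1/2, c = 1, so that c - a - b = -k. On the right
  side k enters only through \<open>of_nat (k choose j) * pochhammer (of_nat k + 1 / 2) j\<close>,
  whose weighted sum over k has a closed form.\<close>

lemma half_ratio_square_expansion:
  "(half_ratio k :: 'a :: field_char_0)\<^sup>2
     = (\<Sum>j\<le>k. (-1) ^ j * of_nat (k choose j) * pochhammer (of_nat k + 1 / 2) j * half_ratio j / fact j)"
proof -
  have refl: "pochhammer (1 - (of_nat k + 1 / 2)) k = ((-1) ^ k * pochhammer (1 / 2) k :: 'a)"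
    using pochhammer_minus[of "of_nat k - 1/2 :: 'a" k] by (simp add: algebra_simps)
  \<comment> \<open>Both factors are k!/j! up to sign; the sign (-1)^(k - j) comes from the k - j
    negative factors starting at -k.\<close>
  have f1: "pochhammer (- of_nat k) (k - j) = ((-1) ^ k * (-1) ^ j * fact k / fact j :: 'a)"
    and f2: "pochhammer (1 + of_nat j) (k - j) = (fact k / fact j :: 'a)" if "j \<le> k" for j
  proof -
    show f2: "pochhammer (1 + of_nat j) (k - j) = (fact k / fact j :: 'a)"
      using pochhammer_product[OF that, of "1 :: 'a"] by (simp add: pochhammer_fact[symmetric] field_simps)
    have "pochhammer (- of_nat k) (k - j) = ((-1) ^ (k - j) * pochhammer (of_nat k - of_nat (k - j) + 1) (k - j) :: 'a)"
      by (rule pochhammer_minus)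
    also have "of_nat k - of_nat (k - j) + 1 = (1 + of_nat j :: 'a)"
      using that by (simp add: of_nat_diff)
    also have "((-1) ^ (k - j) :: 'a) = (-1) ^ k * (-1) ^ j"
      using that by (simp add: minus_one_power_iff)
    finally show "pochhammer (- of_nat k) (k - j) = ((-1) ^ k * (-1) ^ j * fact k / fact j :: 'a)"
      by (simp add: f2)
  qed
  have "pochhammer (1 - (of_nat k + 1 / 2)) k * pochhammer (1 - 1 / 2) k
     = (\<Sum>j\<le>k. of_nat (k choose j) * pochhammer (of_nat k + 1 / 2) j * pochhammer (1 / 2) j
            * pochhammer (1 - (of_nat k + 1 / 2) - 1 / 2) (k - j) * pochhammer (1 + of_nat j) (k - j) :: 'a)"
    by (rule pfaff_saalschuetz[symmetric])
  also have "1 - (of_nat k + 1 / 2) - 1 / 2 = (- of_nat k :: 'a)" by (simp add: field_simps)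
  also have "(\<Sum>j\<le>k. of_nat (k choose j) * pochhammer (of_nat k + 1 / 2) j * pochhammer (1 / 2) j
            * pochhammer (- of_nat k) (k - j) * pochhammer (1 + of_nat j) (k - j) :: 'a)
      = (\<Sum>j\<le>k. ((-1) ^ k * (fact k)\<^sup>2) * 
           ((-1) ^ j * of_nat (k choose j) * pochhammer (of_nat k + 1 / 2) j * half_ratio j / fact j))"
    by (rule sum.cong) (simp_all add: f1 f2 half_ratio_def power2_eq_square mult_ac)
  finally have "(-1) ^ k * (pochhammer (1 / 2) k)\<^sup>2 = (-1) ^ k * (fact k)\<^sup>2 * 
      (\<Sum>j\<le>k. (-1) ^ j * of_nat (k choose j) * pochhammer (of_nat k + 1 / 2) j * half_ratio j / fact j :: 'a)"
    unfolding refl by (simp add: sum_distrib_left power2_eq_square mult_ac)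
  then show ?thesis
    by (simp add: half_ratio_def power_divide field_simps)
qed

lemma two_of_nat_add_one_neq_0 [simp]: "2 * of_nat j + 1 \<noteq> (0 :: 'a :: field_char_0)"
proof -
  have "2 * of_nat j + 1 = (of_nat (2 * j + 1) :: 'a)" by simp
  then show ?thesis by (metis of_nat_eq_0_iff add_is_0 one_neq_zero)
qed

text \<open>For fixed j the summand is the difference of consecutive values of the right side, so
  induction on N has a single rational identity to check.\<close>

lemma sum_half_ratio_telescope:
  "(\<Sum>k\<le>N. (4 * of_nat k + 1) * (half_ratio k)\<^sup>2 * (of_nat (k choose j) * pochhammer (of_nat k + 1 / 2) j))
     = (2 * of_nat N + 1)\<^sup>2 * (half_ratio N)\<^sup>2 / (2 * of_nat j + 1)
         * (of_nat (N choose j) * pochhammer (of_nat N + 3 / 2) j :: 'a :: field_char_0)"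
proof (induction N)
  case 0
  show ?case by (cases j) simp_all
next
  case (Suc N)
  define A where "A = (half_ratio (Suc N) :: 'a)"
  define M where "M = (of_nat N :: 'a)"
  define J where "J = (of_nat j :: 'a)"
  define C where "C = (of_nat (Suc N choose j) :: 'a)"
  define C' where "C' = (of_nat (N choose j) :: 'a)"
  define P where "P = pochhammer (M + 3 / 2) j"
  define P' where "P' = pochhammer (M + 5 / 2) j"
  \<comment> \<open>The relations \<open>A\<close>, \<open>C\<close> and \<open>P\<close> express
    \<open>half_ratio N\<close>, \<open>C'\<close> and \<open>P'\<close> through \<open>A\<close>,
    \<open>C\<close> and \<open>P\<close>, leaving an identity in M and J.\<close>
  have A: "(2 * M + 1)\<^sup>2 * (half_ratio N)\<^sup>2 = (2 * (M + 1))\<^sup>2 * A\<^sup>2"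
    using half_ratio_Suc[of N, where 'a = 'a] by (simp add: A_def M_def flip: power_mult_distrib)
  have C: "C' * (M + 1) = (M + 1 - J) * C"
  proof (cases "j \<le> Suc N")
    case True
    have "Suc N * (N choose j) = (Suc N - j) * (Suc N choose j)"
      using binomial_absorb_comp[of "Suc N" j] by simp
    then have "of_nat (Suc N) * C' = of_nat (Suc N - j) * C"
      unfolding C_def C'_def by (metis of_nat_mult)
    with True show ?thesis
      by (simp add: M_def J_def of_nat_diff mult_ac add_ac)
  next
    case False
    then show ?thesis
      by (simp add: C_def C'_def not_le binomial_eq_0)
  qed
  have P: "(2 * M + 3) * P' = (2 * M + 3 + 2 * J) * P"
  proof -
    have "(M + 3 / 2) * pochhammer (M + 3 / 2 + 1) j = pochhammer (M + 3 / 2) j * (M + 3 / 2 + J)"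
      unfolding J_def using pochhammer_rec[of "M + 3/2" j] pochhammer_Suc[of "M + 3/2" j] by simp
    moreover have "M + 3 / 2 + 1 = M + 5 / 2" by simp
    ultimately have "2 * ((M + 3 / 2) * P') = 2 * (P * (M + 3 / 2 + J))"
      by (simp only: P_def P'_def)
    then show ?thesis by (simp add: algebra_simps)
  qed
  have nz: "2 * J + 1 \<noteq> 0" unfolding J_def by simp
  have "(2 * M + 3)\<^sup>2 * C * P' - 4 * (M + 1)\<^sup>2 * C' * P
      = (2 * M + 3) * C * ((2 * M + 3) * P') - 4 * (M + 1) * P * (C' * (M + 1))"
    by (simp add: power2_eq_square algebra_simps)
  \<comment> \<open>After \<open>C * P\<close> is factored out: (2M+3)(2M+3+2J) - 4(M+1)(M+1-J) =
    (4M+5)(2J+1).\<close>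
  also have "\<dots> = (4 * M + 5) * (2 * J + 1) * C * P"
    unfolding P C by (simp add: algebra_simps)
  finally have key: "4 * (M + 1)\<^sup>2 * C' * P + (4 * M + 5) * (2 * J + 1) * C * P = (2 * M + 3)\<^sup>2 * C * P'"
    by (simp add: algebra_simps)
  have "(\<Sum>k\<le>Suc N. (4 * of_nat k + 1) * (half_ratio k)\<^sup>2 * (of_nat (k choose j) * pochhammer (of_nat k + 1 / 2) j))
     = (2 * (M + 1))\<^sup>2 * A\<^sup>2 / (2 * J + 1) * (C' * P) + (4 * M + 5) * A\<^sup>2 * (C * P)"
  proof -
    have "(1 + M + 1 / 2) = M + 3 / 2" by simp
    then show ?thesis
      by (simp only: sum.atMost_Suc Suc.IH flip: A)
         (simp add: A_def M_def J_def C_def C'_def P_def algebra_simps del: binomial_Suc_Suc)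
  qed
  also have "\<dots> = A\<^sup>2 * (4 * (M + 1)\<^sup>2 * C' * P + (4 * M + 5) * (2 * J + 1) * C * P) / (2 * J + 1)"
    using nz by (simp add: power2_eq_square divide_simps) (simp add: algebra_simps)
  also have "\<dots> = A\<^sup>2 * ((2 * M + 3)\<^sup>2 * C * P') / (2 * J + 1)"
    unfolding key ..
  also have "\<dots> = (2 * of_nat (Suc N) + 1)\<^sup>2 * (half_ratio (Suc N))\<^sup>2 / (2 * of_nat j + 1)
         * (of_nat (Suc N choose j) * pochhammer (of_nat (Suc N) + 3 / 2) j)"
  proof -
    have "2 * of_nat (Suc N) + 1 = 2 * M + 3" "of_nat (Suc N) + 3 / 2 = M + 5 / 2"
      by (simp_all add: M_def)
    then show ?thesis
      by (simp add: A_def J_def C_def P'_def mult_ac add_ac del: binomial_Suc_Suc of_nat_Suc)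
  qed
  finally show ?case .
qed

text \<open>Only one of the two squares in the fourth power is expanded; the other is the weight
  required by the telescoping sum.\<close>

lemma sum_half_ratio_power4:
  "(\<Sum>k\<le>N. (4 * of_nat k + 1) * (half_ratio k :: 'a :: field_char_0) ^ 4)
     = (2 * of_nat N + 1)\<^sup>2 * (half_ratio N)\<^sup>2 *
       (\<Sum>j\<le>N. (-1) ^ j * of_nat (N choose j) * half_ratio j / (2 * of_nat j + 1)
               * (pochhammer (of_nat N + 3 / 2) j / fact j))"
proof -
  \<comment> \<open>Terms with j > k vanish with the binomial coefficient, so j may run up to N for
    every k, and the two sums can be exchanged.\<close>
  have ext: "(half_ratio k :: 'a)\<^sup>2 = (\<Sum>j\<le>N. (-1) ^ j * half_ratio j / fact j
      * (of_nat (k choose j) * pochhammer (of_nat k + 1 / 2) j))" if "k \<le> N" for k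
    unfolding half_ratio_square_expansion using that
    by (intro sum.mono_neutral_cong_left) (auto simp: mult_ac not_le binomial_eq_0)
  have "(\<Sum>k\<le>N. (4 * of_nat k + 1) * (half_ratio k :: 'a) ^ 4)
      = (\<Sum>k\<le>N. (4 * of_nat k + 1) * (half_ratio k)\<^sup>2 * (half_ratio k)\<^sup>2)"
    by (simp add: power_numeral_reduce mult_ac)
  also have "\<dots> = (\<Sum>k\<le>N. \<Sum>j\<le>N. (-1) ^ j * half_ratio j / fact j * 
      ((4 * of_nat k + 1) * (half_ratio k)\<^sup>2 * (of_nat (k choose j) * pochhammer (of_nat k + 1 / 2) j)))"
  proof (rule sum.cong)
    fix k assume "k \<in> {..N}"
    then have k: "k \<le> N" by simp
    show "(4 * of_nat k + 1) * (half_ratio k :: 'a)\<^sup>2 * (half_ratio k)\<^sup>2 = (\<Sum>j\<le>N. (-1) ^ j * half_ratio j / fact j * 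
      ((4 * of_nat k + 1) * (half_ratio k)\<^sup>2 * (of_nat (k choose j) * pochhammer (of_nat k + 1 / 2) j)))"
      by (subst (2) ext[OF k]) (simp add: sum_distrib_left mult_ac)
  qed simp
  also have "\<dots> = (\<Sum>j\<le>N. (-1) ^ j * half_ratio j / fact j * (\<Sum>k\<le>N.
      (4 * of_nat k + 1) * (half_ratio k)\<^sup>2 * (of_nat (k choose j) * pochhammer (of_nat k + 1 / 2) j)))"
    by (subst sum.swap) (simp add: sum_distrib_left)
  also have "\<dots> = (2 * of_nat N + 1)\<^sup>2 * (half_ratio N)\<^sup>2 *
       (\<Sum>j\<le>N. (-1) ^ j * of_nat (N choose j) * half_ratio j / (2 * of_nat j + 1)
               * (pochhammer (of_nat N + 3 / 2) j / fact j))"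
    unfolding sum_half_ratio_telescope by (simp add: sum_distrib_left mult_ac)
  finally show ?thesis .
qed


section \<open>Second use of Pfaff-Saalschuetz: an exactly summable companion sum\<close>

text \<open>With y = n/2 and y = -n/2 this yields the products of 1 + n/(2i) and of 1 -
  n/(2i).\<close>

lemma pochhammer_one_plus_div_fact:
  "pochhammer (1 + y) k / fact k = (\<Prod>i = 1..k. 1 + y / of_nat i :: 'a :: field_char_0)"
proof (induction k)
  case (Suc k)
  have nz: "(1 + of_nat k :: 'a) \<noteq> 0" using of_nat_neq_0[of k] by simp
  have "pochhammer (1 + y) (Suc k) / fact (Suc k)
      = (pochhammer (1 + y) k / fact k) * ((1 + y + of_nat k) / (1 + of_nat k))"
    by (simp add: pochhammer_Suc mult_ac)
  also have "(1 + y + of_nat k) / (1 + of_nat k) = 1 + y / of_nat (Suc k)"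
    using nz by (simp add: divide_simps)
  finally show ?case using Suc.IH by (simp add: mult_ac)
qed simp

text \<open>Pfaff-Saalschuetz with a = b = 1/2 and c = 3/2: here c - a = c - b = 1, so the closed
  form is (N!)^2.\<close>

lemma sum_half_ratio_saalschuetz:
  fixes N :: nat
  defines "n \<equiv> 2 * of_nat N + 1 :: rat"
  shows "n * (half_ratio N)\<^sup>2 * (\<Sum>j\<le>N. (-1) ^ j * of_nat (N choose j) * half_ratio j / (2 * of_nat j + 1)
               / (\<Prod>i = 1..j. 1 - n / (2 * of_nat i))) = 1"
proof -
  define H where "H = pochhammer (1 / 2 :: rat)"
  define P where "P = (\<lambda>j. \<Prod>i = 1..j. 1 - n / (2 * of_nat i))"
  have Hpos: "H k > 0" for k unfolding H_def by (rule pochhammer_pos) simp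
  have three_half: "pochhammer (3 / 2) k = (2 * of_nat k + 1) * H k" for k
    using pochhammer_rec[of "1 / 2 :: rat" k] pochhammer_Suc[of "1 / 2 :: rat" k]
    by (simp add: H_def field_simps)
  have term_eq: "of_nat (N choose k) * H k * H k * pochhammer (3 / 2 - 1 / 2 - 1 / 2) (N - k)
        * pochhammer (3 / 2 + of_nat k) (N - k)
      = n * (H N)\<^sup>2 * ((-1) ^ k * of_nat (N choose k) * half_ratio k / (2 * of_nat k + 1) / P k)"
    if "k \<le> N" for k
  proof -
    have "(2 * of_nat k + 1) * H k * pochhammer (3 / 2 + of_nat k) (N - k) = n * H N"
      using pochhammer_product[OF that, of "3 / 2 :: rat"] by (simp add: three_half n_def)
    then have e1: "pochhammer (3 / 2 + of_nat k) (N - k) = n * H N / ((2 * of_nat k + 1) * H k)"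
      using Hpos[of k] by (simp add: nonzero_eq_divide_eq mult_ac)
    \<comment> \<open>Since 1 - n/2 = 1/2 - N, reversing the factors gives, up to sign, the last k
      factors of \<open>H N\<close>. Thus \<open>H (N - k)\<close> contributes the inverse of
      \<open>P k\<close>.\<close>
    have "fact k * P k = pochhammer (1 + (- (n / 2))) k"
      using pochhammer_one_plus_div_fact[of "- (n / 2)" k] by (simp add: P_def field_simps)
    also have "1 + (- (n / 2)) = - (of_nat N - 1 / 2)"
      by (simp add: n_def field_simps)
    also have "pochhammer \<dots> k = (-1) ^ k * pochhammer (of_nat N - 1 / 2 - of_nat k + 1) k"
      by (rule pochhammer_minus)
    also have "of_nat N - 1 / 2 - of_nat k + 1 = (1 / 2 :: rat) + of_nat (N - k)"
      using that by (simp add: of_nat_diff)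
    finally have FP: "fact k * P k = (-1) ^ k * pochhammer (1 / 2 + of_nat (N - k)) k" .
    have "pochhammer (1 / 2 + of_nat (N - k)) k > (0 :: rat)"
      by (rule pochhammer_pos) (simp add: add_pos_nonneg)
    moreover have "H N = H (N - k) * pochhammer (1 / 2 + of_nat (N - k)) k"
      using pochhammer_product[of "N - k" N "1 / 2 :: rat"] that by (simp add: H_def)
    ultimately have "H (N - k) * (fact k * P k) = (-1) ^ k * H N" and Pnz: "P k \<noteq> 0"
      using FP by auto
    then have e2: "H (N - k) = (-1) ^ k * H N / (fact k * P k)"
      by (simp add: nonzero_eq_divide_eq)
    have "3 / 2 - 1 / 2 - 1 / 2 = (1 / 2 :: rat)" by simp
    then show ?thesis
      using Hpos[of k] Pnz e2 unfolding e1 half_ratio_def H_def[symmetric]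
      by (simp add: H_def[symmetric] power2_eq_square mult_ac)
  qed
  have "(fact N :: rat)\<^sup>2 = pochhammer (3 / 2 - 1 / 2) N * pochhammer (3 / 2 - 1 / 2) N"
    by (simp add: pochhammer_fact power2_eq_square)
  also have "\<dots> = (\<Sum>k\<le>N. of_nat (N choose k) * H k * H k * pochhammer (3 / 2 - 1 / 2 - 1 / 2) (N - k)
        * pochhammer (3 / 2 + of_nat k) (N - k))"
    unfolding H_def by (rule pfaff_saalschuetz[symmetric])
  also have "\<dots> = n * (H N)\<^sup>2 * (\<Sum>k\<le>N. (-1) ^ k * of_nat (N choose k) * half_ratio k / (2 * of_nat k + 1) / P k)"
    unfolding sum_distrib_left by (intro sum.cong refl term_eq) simp
  also have "H N = half_ratio N * fact N"
    by (simp add: H_def half_ratio_def)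
  finally show ?thesis
    by (simp add: P_def power_mult_distrib)
qed

section \<open>Divisibility in the localization at p\<close>

text \<open>The denominator in lowest terms divides b, so it inherits coprimality to p from any
  representation of the fraction.\<close>

lemma localized_ints_fraction:
  assumes "coprime b (int p)" and "b \<noteq> 0"
  shows "of_int a / of_int b \<in> localized_ints p"
proof -
  define x where "x = (of_int a / of_int b :: rat)"
  obtain c d where cd: "quotient_of x = (c, d)" by force
  have d: "d > 0" "coprime c d" using quotient_of_denom_pos[OF cd] quotient_of_coprime[OF cd] by auto
  have "(of_int (c * b) :: rat) = of_int (a * d)"
    using quotient_of_div[OF cd] d assms(2) by (simp add: x_def frac_eq_eq)
  then have "c * b = a * d" by (simp only: of_int_eq_iff)
  then have "d dvd c * b" by simp
  with d have "d dvd b" by (simp add: coprime_dvd_mult_right_iff coprime_commute)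
  with assms(1) have "coprime d (int p)" using coprime_divisors dvd_refl by blast
  then show ?thesis by (simp add: localized_ints_def cd flip: x_def)
qed

lemma localized_intsE:
  assumes "x \<in> localized_ints p"
  obtains a b where "x = of_int a / of_int b" "coprime b (int p)" "b \<noteq> 0"
proof -
  obtain c d where cd: "quotient_of x = (c, d)" by force
  with assms have "coprime d (int p)" by (simp add: localized_ints_def)
  with that quotient_of_div[OF cd] quotient_of_denom_pos[OF cd] show thesis by auto
qed

lemma localized_ints_of_int [simp]: "of_int a \<in> localized_ints p"
  using localized_ints_fraction[of 1 p a] by simp

lemma localized_ints_of_nat [simp]: "of_nat a \<in> localized_ints p"
  using localized_ints_of_int[of "int a" p] by simp

lemma localized_ints_0 [simp]: "0 \<in> localized_ints p"
  using localized_ints_of_int[of 0 p] by simp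

lemma localized_ints_1 [simp]: "1 \<in> localized_ints p"
  using localized_ints_of_int[of 1 p] by simp

lemma localized_ints_add:
  assumes "x \<in> localized_ints p" "y \<in> localized_ints p"
  shows "x + y \<in> localized_ints p"
proof -
  from assms obtain a b c d where "x = of_int a / of_int b" "coprime b (int p)" "b \<noteq> 0"
    "y = of_int c / of_int d" "coprime d (int p)" "d \<noteq> 0" by (metis localized_intsE)
  then show ?thesis
    using localized_ints_fraction[of "b * d" p "a * d + c * b"] by (simp add: add_frac_eq)
qed

lemma localized_ints_mult:
  assumes "x \<in> localized_ints p" "y \<in> localized_ints p"
  shows "x * y \<in> localized_ints p"
proof -
  from assms obtain a b c d where "x = of_int a / of_int b" "coprime b (int p)" "b \<noteq> 0"
    "y = of_int c / of_int d" "coprime d (int p)" "d \<noteq> 0" by (metis localized_intsE)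
  then show ?thesis
    using localized_ints_fraction[of "b * d" p "a * c"] by simp
qed

lemma localized_ints_power: "x \<in> localized_ints p \<Longrightarrow> x ^ k \<in> localized_ints p"
  by (induction k) (simp_all add: localized_ints_mult)

section \<open>Divisibility by powers of p as congruence to 0\<close>

text \<open>Integrality is divisibility by p^0, so the product rule for congruences to 0 also covers
  p-integral factors.\<close>

lemma localized_ints_iff_rat_cong: "x \<in> localized_ints p \<longleftrightarrow> rat_cong x 0 p 0"
  by (simp add: rat_cong_def)

lemma rat_cong_iff_diff: "rat_cong x y p m \<longleftrightarrow> rat_cong (x - y) 0 p m"
  by (simp add: rat_cong_def)

lemma rat_cong_0_0 [simp]: "rat_cong 0 0 p m"
  unfolding rat_cong_def by (intro bexI[of _ 0]) simp_all

lemma rat_cong_0_add: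
  assumes "rat_cong x 0 p m" "rat_cong y 0 p m"
  shows "rat_cong (x + y) 0 p m"
proof -
  from assms obtain u v where "u \<in> localized_ints p" "x = of_nat (p ^ m) * u"
    "v \<in> localized_ints p" "y = of_nat (p ^ m) * v" unfolding rat_cong_def by auto
  then show ?thesis
    unfolding rat_cong_def by (intro bexI[of _ "u + v"]) (simp_all add: distrib_left localized_ints_add)
qed

lemma rat_cong_0_sum:
  "(\<And>i. i \<in> I \<Longrightarrow> rat_cong (f i) 0 p m) \<Longrightarrow> rat_cong (sum f I) 0 p m"
  by (induction I rule: infinite_finite_induct) (simp_all add: rat_cong_0_add)

lemma rat_cong_0_mult:
  assumes "rat_cong x 0 p l" "rat_cong y 0 p m"
  shows "rat_cong (x * y) 0 p (l + m)"
proof -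
  from assms obtain u v where "u \<in> localized_ints p" "x = of_nat (p ^ l) * u"
    "v \<in> localized_ints p" "y = of_nat (p ^ m) * v" unfolding rat_cong_def by auto
  then show ?thesis
    unfolding rat_cong_def by (intro bexI[of _ "u * v"]) (simp_all add: power_add localized_ints_mult)
qed

lemma rat_cong_0_mult_left:
  "u \<in> localized_ints p \<Longrightarrow> rat_cong x 0 p m \<Longrightarrow> rat_cong (u * x) 0 p m"
  using rat_cong_0_mult[of u p 0 x m] by (simp add: localized_ints_iff_rat_cong)

lemma rat_cong_0_power:
  "rat_cong x 0 p m \<Longrightarrow> rat_cong (x ^ k) 0 p (k * m)"
  by (induction k) (simp_all add: rat_cong_0_mult flip: localized_ints_iff_rat_cong)

lemma rat_cong_0_uminus: "rat_cong x 0 p m \<Longrightarrow> rat_cong (- x) 0 p m"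
  using rat_cong_0_mult_left[of "-1" p x m] localized_ints_of_int[of "-1" p] by simp

lemma rat_cong_0_diff:
  "rat_cong x 0 p m \<Longrightarrow> rat_cong y 0 p m \<Longrightarrow> rat_cong (x - y) 0 p m"
  using rat_cong_0_add[of x p m "- y"] by (simp add: rat_cong_0_uminus)

lemma rat_cong_0_mono:
  assumes "rat_cong x 0 p m" "l \<le> m"
  shows "rat_cong x 0 p l"
proof -
  from assms obtain u where "u \<in> localized_ints p" "x = of_nat (p ^ m) * u"
    unfolding rat_cong_def by auto
  moreover have "(of_nat (p ^ m) :: rat) = of_nat (p ^ l) * of_nat (p ^ (m - l))"
    using assms(2) by (simp flip: power_add)
  ultimately show ?thesis unfolding rat_cong_def
    by (intro bexI[of _ "of_nat (p ^ (m - l)) * u"]) (simp_all only: diff_zero mult.assoc localized_ints_mult localized_ints_of_nat)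
qed

section \<open>Units and p-integrality of the numbers that occur\<close>

text \<open>If 1 - x = p a / b, then x = (b - p a) / b, with numerator and denominator both prime to
  p.\<close>

lemma localized_ints_inverse_unit:
  assumes "prime p" "rat_cong (1 - x) 0 p 1"
  shows "x \<noteq> 0" "1 / x \<in> localized_ints p"
proof -
  from assms(2) obtain y where y: "y \<in> localized_ints p" "1 - x = of_nat p * y"
    unfolding rat_cong_def by auto
  from y(1) obtain a b where ab: "y = of_int a / of_int b" "coprime b (int p)" "b \<noteq> 0"
    by (rule localized_intsE)
  define c where "c = b - int p * a"
  have cp: "coprime c (int p)"
  proof (rule coprimeI)
    fix d assume "d dvd c" "d dvd int p"
    then have "d dvd c + int p * a" by simp
    then have "d dvd b" by (simp add: c_def)
    with \<open>d dvd int p\<close> ab(2) show "is_unit d" using coprime_common_divisor by blast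
  qed
  have "c \<noteq> 0" using cp assms(1) by (auto simp: prime_gt_1_nat)
  have "x = of_int c / of_int b"
    using y(2) ab by (simp add: c_def field_simps)
  with \<open>c \<noteq> 0\<close> ab cp show "x \<noteq> 0" "1 / x \<in> localized_ints p"
    using localized_ints_fraction[of c p b] by auto
qed

text \<open>As m < p^r, the exponent of p in m is less than r, so a factor p survives in the
  quotient.\<close>

lemma prime_power_div_rat_cong_0:
  assumes "prime p" "0 < m" "m < p ^ r"
  shows "rat_cong (of_nat (p ^ r) / of_nat m) 0 p 1"
proof -
  obtain s q where sq: "m = p ^ s * q" "\<not> p dvd q"
    using prime_power_canonical[OF assms(1,2)] by (auto simp: mult.commute)
  have "q > 0" using sq assms by (cases q) auto
  then have "p ^ s \<le> m" using sq by simp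
  then have "p ^ s < p ^ r" using assms by simp
  then have "s < r" using power_less_imp_less_exp prime_gt_1_nat[OF assms(1)] by blast
  then obtain d where d: "r = s + 1 + d" using less_iff_Suc_add by auto
  have "coprime q p" using sq(2) assms(1) by (metis coprime_commute prime_imp_coprime)
  then have "of_int (int (p ^ d)) / of_int (int q) \<in> localized_ints p"
    by (intro localized_ints_fraction) (use \<open>q > 0\<close> in auto)
  moreover have "of_nat (p ^ r) / of_nat m = of_nat (p ^ 1) * (of_int (int (p ^ d)) / of_int (int q) :: rat)"
    using prime_gt_0_nat[OF assms(1)] by (simp add: sq d power_add)
  ultimately show ?thesis unfolding rat_cong_def by (metis diff_zero)
qed

text \<open>In the form (2k choose k) / 4^k, the denominator is prime to odd p.\<close>

lemma half_ratio_localized: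
  assumes "odd p"
  shows "half_ratio k \<in> localized_ints p"
proof -
  have "fact (2 * k) = (2 ^ (2 * k) * pochhammer (1 / 2) k * fact k :: rat)"
    by (rule fact_double)
  moreover have "of_nat ((2 * k) choose k) = (fact (2 * k) / (fact k * fact k) :: rat)"
    by (subst binomial_fact) simp_all
  ultimately have "half_ratio k = (of_int (int ((2 * k) choose k)) / of_int (2 ^ (2 * k)) :: rat)"
    by (simp add: half_ratio_def)
  then show ?thesis using assms localized_ints_fraction[of "2 ^ (2 * k)" p "int ((2 * k) choose k)"] by simp
qed

section \<open>The congruence\<close>

context
  fixes p r N n :: nat
  assumes p: "prime p" "p > 3"
    and n: "n = p ^ r" "n = 2 * N + 1"
begin

private definition x :: "nat \<Rightarrow> rat" where
  "x i = of_nat n / (2 * of_nat i)"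

private lemma odd_p: "odd p"
  using p prime_odd_nat by force

private lemma x_cong: "i \<in> {1..N} \<Longrightarrow> rat_cong (x i) 0 p 1"
  unfolding x_def using prime_power_div_rat_cong_0[OF p(1), of "2 * i" r] n by simp

private lemma x2_cong: "i \<in> {1..N} \<Longrightarrow> rat_cong ((x i)\<^sup>2) 0 p 2"
  using rat_cong_0_power[OF x_cong, of i 2] by simp

text \<open>The map sending \<open>j\<close> to whichever of \<open>2 j\<close> and \<open>n - 2 j\<close> is at most \<open>N\<close> permutes \<open>{1..N}\<close>, and
  \<open>(n / (n - 2 j))\<^sup>2\<close> is congruent to \<open>(n / (2 j))\<^sup>2\<close> modulo \<open>p\<^sup>3\<close>. Hence the sum \<open>T\<close> of
  the \<open>(n / j)\<^sup>2\<close> satisfies \<open>T \<equiv> T / 4\<close>.\<close>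

private lemma sum_x2_cong: "rat_cong (\<Sum>i = 1..N. (x i)\<^sup>2) 0 p 3"
proof -
  define s where "s = (\<lambda>j. if 2 * j \<le> N then 2 * j else n - 2 * j)"
  have "s ` {1..N} \<subseteq> {1..N}" using n(2) by (auto simp: s_def)
  \<comment> \<open>As n is odd, the even values 2j and the odd values n - 2j never collide.\<close>
  moreover have "inj_on s {1..N}"
    unfolding s_def inj_on_def using n(2) by (auto split: if_splits) presburger+
  ultimately have bij: "bij_betw s {1..N} {1..N}"
    by (simp add: bij_betw_def endo_inj_surj)
  have s_cong: "rat_cong (4 * (x (s j))\<^sup>2 - (x j)\<^sup>2) 0 p 3" if j: "j \<in> {1..N}" for j
  proof (cases "2 * j \<le> N")
    case True
    then have "4 * (x (s j))\<^sup>2 = (x j)\<^sup>2"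
      using j by (simp add: s_def x_def power2_eq_square)
    then show ?thesis by simp
  next
    case False
    have u: "1 - x j \<noteq> 0" "1 / (1 - x j) \<in> localized_ints p"
      using localized_ints_inverse_unit[OF p(1), of "1 - x j"] x_cong[OF j] by auto
    \<comment> \<open>Here n / (n - 2j) = -(x j) w. The relation w - 1 = w (x j) supplies the third
      factor \<open>x j\<close> in the difference of squares.\<close>
    define w where "w = 1 / (1 - x j)"
    have w: "w \<in> localized_ints p" "w - w * x j = 1"
      using u by (auto simp: w_def field_simps)
    have "2 * x (s j) = - (x j * w)"
    proof -
      have "2 * x (s j) = of_nat n / of_nat (s j)"
        by (simp add: x_def)
      also have "of_nat (s j) = (of_nat n - 2 * of_nat j :: rat)"
        using False j n(2) by (simp add: s_def of_nat_diff)
      also have "of_nat n / (of_nat n - 2 * of_nat j) = - (x j * w)"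
        using u(1) j by (simp add: x_def w_def field_simps)
      finally show ?thesis .
    qed
    then have "(2 * x (s j))\<^sup>2 = (- (x j * w))\<^sup>2" by simp
    then have "4 * (x (s j))\<^sup>2 = (x j * w)\<^sup>2" by (simp add: power_mult_distrib)
    also have "\<dots> - (x j)\<^sup>2 = ((1 + w) * w) * (x j ^ 3)"
    proof -
      have "(x j * w)\<^sup>2 - (x j)\<^sup>2 = (x j)\<^sup>2 * (1 + w) * (w - 1)"
        by (simp add: power2_eq_square algebra_simps)
      also have "w - 1 = w * x j" using w(2) by (simp add: algebra_simps)
      finally show ?thesis by (simp only: power2_eq_square power3_eq_cube mult_ac)
    qed
    finally have eq: "4 * (x (s j))\<^sup>2 - (x j)\<^sup>2 = ((1 + w) * w) * (x j ^ 3)" .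
    show ?thesis unfolding eq
      using w(1) rat_cong_0_power[OF x_cong[OF j], of 3]
      by (intro rat_cong_0_mult_left localized_ints_mult localized_ints_add) simp_all
  qed
  have "(\<Sum>j = 1..N. 4 * (x (s j))\<^sup>2 - (x j)\<^sup>2) = 4 * (\<Sum>j = 1..N. (x (s j))\<^sup>2) - (\<Sum>j = 1..N. (x j)\<^sup>2)"
    by (simp add: sum_subtractf sum_distrib_left)
  also have "(\<Sum>j = 1..N. (x (s j))\<^sup>2) = (\<Sum>j = 1..N. (x j)\<^sup>2)"
    by (rule sum.reindex_bij_betw[OF bij])
  finally have "(\<Sum>j = 1..N. (x j)\<^sup>2) = (1 / 3) * (\<Sum>j = 1..N. 4 * (x (s j))\<^sup>2 - (x j)\<^sup>2)"
    by simp
  \<comment> \<open>After reindexing, the sum of differences is 4 - 1 = 3 times the sum of squares,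
    so 3 has to be a unit at p.\<close>
  moreover have "1 / 3 \<in> localized_ints p"
  proof -
    have "\<not> p dvd 3" using p(2) dvd_imp_le[of p 3] by auto
    then have "coprime p 3" using p(1) by (rule prime_imp_coprime[rotated])
    then have "coprime 3 (int p)" by (metis coprime_commute coprime_int_iff of_nat_numeral)
    then show ?thesis using localized_ints_fraction[of 3 p 1] by simp
  qed
  ultimately show ?thesis
    using s_cong by (simp only:) (intro rat_cong_0_mult_left rat_cong_0_sum)
qed

text \<open>Both congruences go through one induction: the one modulo p^2 puts the cross term
  \<open>(Q - 1) * y\<close> into p^4, which the one modulo p^4 needs.\<close>

private lemma prod_one_minus_x2_cong:
  "k \<le> N \<Longrightarrow> rat_cong ((\<Prod>i = 1..k. 1 - (x i)\<^sup>2) - 1) 0 p 2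
     \<and> rat_cong ((\<Prod>i = 1..k. 1 - (x i)\<^sup>2) - 1 + (\<Sum>i = 1..k. (x i)\<^sup>2)) 0 p 4"
proof (induction k)
  case (Suc k)
  define Q where "Q = (\<Prod>i = 1..k. 1 - (x i)\<^sup>2)"
  define S where "S = (\<Sum>i = 1..k. (x i)\<^sup>2)"
  define y where "y = (x (Suc k))\<^sup>2"
  have IH: "rat_cong (Q - 1) 0 p 2" "rat_cong (Q - 1 + S) 0 p 4"
    using Suc by (auto simp: Q_def S_def)
  have y: "rat_cong y 0 p 2" using x2_cong[of "Suc k"] Suc.prems by (simp add: y_def)
  have Qy: "rat_cong ((Q - 1) * y) 0 p 4" using rat_cong_0_mult[OF IH(1) y] by simp
  have "Q * (1 - y) - 1 = (Q - 1) - (Q - 1) * y - y" "Q * (1 - y) - 1 + (S + y) = (Q - 1 + S) - (Q - 1) * y"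
    by (simp_all add: algebra_simps)
  moreover have "rat_cong ((Q - 1) - (Q - 1) * y - y) 0 p 2"
    using IH(1) y rat_cong_0_mono[OF Qy, of 2] by (simp add: rat_cong_0_diff)
  moreover have "rat_cong ((Q - 1 + S) - (Q - 1) * y) 0 p 4"
    using IH(2) Qy by (rule rat_cong_0_diff)
  ultimately have "rat_cong (Q * (1 - y) - 1) 0 p 2" "rat_cong (Q * (1 - y) - 1 + (S + y)) 0 p 4"
    by metis+
  then show ?case by (simp add: Q_def S_def y_def)
qed simp

text \<open>Each factor is congruent to 1 modulo p, hence a unit; division by the product therefore
  preserves p-integrality.\<close>

private lemma prod_one_minus_x_unit:
  assumes "k \<le> N"
  shows "(\<Prod>i = 1..k. 1 - x i) \<noteq> 0 \<and> 1 / (\<Prod>i = 1..k. 1 - x i) \<in> localized_ints p"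
  using assms
proof (induction k)
  case (Suc k)
  have "1 - x (Suc k) \<noteq> 0" "1 / (1 - x (Suc k)) \<in> localized_ints p"
    using localized_ints_inverse_unit[OF p(1), of "1 - x (Suc k)"] x_cong[of "Suc k"] Suc.prems by auto
  moreover have "(\<Prod>i = 1..Suc k. 1 - x i) = (\<Prod>i = 1..k. 1 - x i) * (1 - x (Suc k))"
    by simp
  ultimately show ?case
    using Suc localized_ints_mult[of "1 / (\<Prod>i = 1..k. 1 - x i)" p "1 / (1 - x (Suc k))"]
    by (simp only: times_divide_times_eq mult_1 mult_eq_0_iff) simp
qed simp

lemma sum_half_ratio_power4_rat_cong:
  "rat_cong (\<Sum>k\<le>N. (4 * of_nat k + 1) * half_ratio k ^ 4) (of_nat n) p (3 + r)"
proof -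
  define A where "A = (half_ratio N :: rat)"
  define B where "B = (\<lambda>j. (-1) ^ j * of_nat (N choose j) * half_ratio j :: rat)"
  define P where "P = (\<lambda>j. \<Prod>i = 1..j. 1 - x i)"
  define P' where "P' = (\<lambda>j. \<Prod>i = 1..j. 1 + x i)"
  define Q where "Q = (\<lambda>j. \<Prod>i = 1..j. 1 - (x i)\<^sup>2)"
  define m where "m = (\<lambda>j. of_nat n / of_nat (2 * j + 1) :: rat)"
  have n_eq: "2 * of_nat N + 1 = (of_nat n :: rat)" by (simp add: n(2))
  have P: "P j \<noteq> 0" "1 / P j \<in> localized_ints p" if "j \<le> N" for j
    using prod_one_minus_x_unit[OF that] by (auto simp: P_def)
  have PP: "P' j * P j = Q j" for j
    unfolding P_def P'_def Q_def prod.distrib[symmetric]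
    by (rule prod.cong) (simp_all add: power2_eq_square algebra_simps)
  have poch: "pochhammer (of_nat N + 3 / 2) j / fact j = P' j" for j
  proof -
    have "of_nat N + 3 / 2 = 1 + (of_nat n / 2 :: rat)" by (simp add: n(2) field_simps)
    then show ?thesis unfolding P'_def x_def by (simp add: pochhammer_one_plus_div_fact)
  qed
  have S: "(\<Sum>k\<le>N. (4 * of_nat k + 1) * half_ratio k ^ 4)
      = of_nat n * A\<^sup>2 * (\<Sum>j\<le>N. m j * (B j * P' j))"
    unfolding sum_half_ratio_power4 poch n_eq
    by (simp add: A_def B_def m_def sum_distrib_left power2_eq_square mult_ac add_ac)
  \<comment> \<open>The target n is written in the same shape as \<open>S\<close>, with
    \<open>1 / P j\<close> in place of \<open>P' j\<close>, so that the two can be compared term by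
    term.\<close>
  have T: "of_nat n = of_nat n * A\<^sup>2 * (\<Sum>j\<le>N. m j * (B j / P j))"
  proof -
    have "of_nat n = of_nat n * (of_nat n * A\<^sup>2 * (\<Sum>j\<le>N. B j / (2 * of_nat j + 1) / P j))"
      using sum_half_ratio_saalschuetz[of N] by (simp add: A_def B_def P_def x_def n_eq)
    then show ?thesis by (simp add: m_def sum_distrib_left mult_ac add_ac)
  qed
  have B: "B j \<in> localized_ints p" for j
    unfolding B_def using localized_ints_of_int[of "(-1) ^ j" p]
    by (intro localized_ints_mult half_ratio_localized odd_p) simp_all
  have Q_cong: "rat_cong (m j * (Q j - 1)) 0 p 3" if "j \<le> N" for j
  proof (cases "j = N")
    case True
    have "rat_cong (Q N - 1 + (\<Sum>i = 1..N. (x i)\<^sup>2)) 0 p 3"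
      using prod_one_minus_x2_cong[of N] by (auto simp: Q_def intro: rat_cong_0_mono)
    from rat_cong_0_diff[OF this sum_x2_cong] have "rat_cong (Q N - 1) 0 p 3" by simp
    moreover have "m N = 1" by (simp add: m_def n(2) del: of_nat_add of_nat_mult)
    ultimately show ?thesis using True by simp
  next
    case False
    \<comment> \<open>For j < N the denominator 2j + 1 lies below n = p^r.\<close>
    then have "rat_cong (m j) 0 p 1"
      unfolding m_def n(1) using that n by (intro prime_power_div_rat_cong_0 p) auto
    moreover have "rat_cong (Q j - 1) 0 p 2"
      using prod_one_minus_x2_cong[OF that] by (simp add: Q_def)
    ultimately show ?thesis using rat_cong_0_mult[of "m j" p 1 "Q j - 1" 2] by (simp add: numeral_3_eq_3)
  qed
  have "(\<Sum>k\<le>N. (4 * of_nat k + 1) * half_ratio k ^ 4) - of_nat n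
      = of_nat n * A\<^sup>2 * ((\<Sum>j\<le>N. m j * (B j * P' j)) - (\<Sum>j\<le>N. m j * (B j / P j)))"
    using arg_cong2[OF S T, of "(-)"] by (simp only: right_diff_distrib)
  \<comment> \<open>From \<open>P' j * P j = Q j\<close> it follows that P' - 1/P = (Q -
    1)/P.\<close>
  also have "(\<Sum>j\<le>N. m j * (B j * P' j)) - (\<Sum>j\<le>N. m j * (B j / P j))
      = (\<Sum>j\<le>N. (B j * (1 / P j)) * (m j * (Q j - 1)))"
    unfolding sum_subtractf[symmetric]
    by (rule sum.cong) (simp_all add: P(1) PP[symmetric] diff_divide_distrib right_diff_distrib mult_ac)
  finally have eq: "(\<Sum>k\<le>N. (4 * of_nat k + 1) * half_ratio k ^ 4) - of_nat n
      = A\<^sup>2 * (\<Sum>j\<le>N. (B j * (1 / P j)) * (m j * (Q j - 1))) * of_nat n"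
    by (simp add: mult_ac)
  \<comment> \<open>The cofactors \<open>A\<close>, \<open>B j\<close> and \<open>1 / P j\<close>
    are p-integral, so p^3 comes from \<open>m j * (Q j - 1)\<close>; the remaining factor n
    contributes p^r.\<close>
  have "rat_cong (A\<^sup>2 * (\<Sum>j\<le>N. (B j * (1 / P j)) * (m j * (Q j - 1)))) 0 p 3"
    unfolding A_def using B P(2) Q_cong
    by (auto intro!: rat_cong_0_mult_left[of "_ ^ 2"] rat_cong_0_sum rat_cong_0_mult_left[of "B _ * _"]
          localized_ints_power half_ratio_localized odd_p localized_ints_mult simp del: times_divide_eq_right)
  moreover have "rat_cong (of_nat n) 0 p r"
    unfolding rat_cong_def n(1) by (intro bexI[of _ 1]) simp_all
  ultimately show ?thesis
    by (subst rat_cong_iff_diff) (simp only: eq rat_cong_0_mult)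
qed

end

theorem theorem1:
  fixes p r :: nat
  assumes "prime p" and "p > 3" and "r > 0"
  shows "rat_cong
           (\<Sum>k = 0..(p ^ r - 1) div 2.
              (4 * of_nat k + 1) * (pochhammer (1 / 2) k / fact k) ^ 4)
           (of_nat (p ^ r)) p (3 + r)"
proof -
  have "odd (p ^ r)" using assms prime_odd_nat[of p] by simp
  then have "p ^ r = 2 * ((p ^ r - 1) div 2) + 1" by simp
  from sum_half_ratio_power4_rat_cong[OF assms(1,2) refl this] show ?thesis
    by (simp add: half_ratio_def atLeast0AtMost)
qed

end
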